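(* Let $n\in\mathbb{N}$ and let $t\ne0$ be a real number with $-1\leq t<1$ if $n=1$ and $|t|\leq 1$ if $n\geq 2$. Then $$ \begin{aligned} \sum_{k=1}^{\infty}\frac{t^k}{\binom{n+k}{k}}={}&\frac{1}{(1-t)^2}\sum_{k=1}^n(t-k)\left(H_k+H_{n-k}-H_{n}\right)\left(\frac{t-1}{t}\right)^k\\ &-\frac{1}{t}\sum_{k=0}^{n-2}\frac{1}{k+2}\left(\frac{t-1}{t}\right)^k+\frac{2t+n\log(1-t)}{1-t}\left(\frac{t-1}{t}\right)^n+1, \end{aligned} $$ where for $t=1$ (allowed only if $n\ge2$) the right-hand side is understood as its limit as $t\to1^-$.
   Context: $\mathbb{N}=\{1,2,3,\dots\}$. $H_m=\sum_{j=1}^m\frac1j$, with $H_0=0$. An empty sum is $0$ (so the sum over $0\le k\le n-2$ is $0$ when $n=1$). Infinite series are limits of partial sums (possibly only conditionally convergent). *)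

theory Defs
  imports "HOL-Analysis.Analysis"
begin

(* The closed form as a real expression; it has its intended meaning for t < 1, t \<noteq> 0.
   The sum over 0 <= k <= n - 2 is written k < n - 1, which for n = 1 is empty.
   The value at t = 1 (where Isabelle's x / 0 = 0 and ln 0 = 0 would apply) is never used;
   only the limit from the left is. *)
definition closed_form :: "nat \<Rightarrow> real \<Rightarrow> real" where
  "closed_form n t =
     1 / (1 - t)\<^sup>2 *
       (\<Sum>k=1..n. (t - real k) * (harm k + harm (n - k) - harm n) * ((t - 1) / t) ^ k)
     - 1 / t * (\<Sum>k<n - 1. 1 / (real k + 2) * ((t - 1) / t) ^ k)
     + (2 * t + real n * ln (1 - t)) / (1 - t) * ((t - 1) / t) ^ n
     + 1"

end

theory Submission
  imports Defs "HOL-Real_Asymp.Real_Asymp"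
begin

text \<open>
  Since \<open>1 / (n * (n + k choose k))\<close> is the Beta integral of \<open>x ^ k * (1 - x) ^ (n - 1)\<close>
  over \<open>[0, 1]\<close>, the series with its \<open>k = 0\<close> term included is \<open>n\<close> times the integral
  \<open>I n\<close> of \<open>(1 - x) ^ (n - 1) / (1 - t * x)\<close>.  With \<open>w = (t - 1) / t\<close> we have
  \<open>1 - x = (1 - t * x) / t + w\<close>, whence \<open>I (n + 1) = 1 / (n * t) + w * I n\<close>, and
  \<open>I 1 = - ln (1 - t) / t\<close>.  Solving this recurrence expresses the series through \<open>w ^ (n - 1)\<close>
  times the logarithm and a finite sum of powers of \<open>w\<close> (\<open>beta_value\<close>).

  No integral occurs in the proof: the recurrence is the Pascal-type identity
  \<open>beta_coeff_diff\<close> for the coefficients, summed against \<open>t ^ k\<close> (\<open>beta_series_step\<close>).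
  This manipulates only convergent series, so it covers \<open>t = -1\<close>
  as soon as the logarithmic series is known to converge there.

  To recognise the closed form, write \<open>t - k = t * (1 - k * (1 - w))\<close>.  Summation by parts
  then replaces \<open>c k = H k + H (n - k) - H n\<close> by \<open>k * (c k - c (k + 1))\<close>, which equals
  \<open>k / (n - k) - k / (k + 1) = n / (n - k) - 2 + 1 / (k + 1)\<close>.  The first part gives the finite
  sum coming from the recurrence, the last one cancels against the second sum of the closed form,
  and the constant \<open>-2\<close> gives a geometric sum, which absorbs the remaining term with
  \<open>2 * t\<close> (\<open>closed_form_eq_beta_value\<close>).

  At \<open>t = 1\<close> the recurrence cannot be started, because the series for \<open>n = 1\<close> diverges; there
  the identity for the coefficients makes the series telescope to \<open>1 / (n - 1)\<close>.  This is the
  limit of \<open>beta_value\<close>: only its constant term survives as \<open>w\<close> tends to \<open>0\<close>, since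
  \<open>w * ln (1 - t)\<close> tends to \<open>0\<close>.
\<close>

text \<open>For \<open>n \<ge> 1\<close> this is the value \<open>B(k + 1, n)\<close> of Euler's Beta function.\<close>

definition beta_coeff :: "nat \<Rightarrow> nat \<Rightarrow> real" where
  "beta_coeff n k = 1 / (real n * real ((n + k) choose k))"

lemma beta_coeff_0 [simp]: "beta_coeff n 0 = 1 / real n"
  by (simp add: beta_coeff_def)

lemma beta_coeff_1: "beta_coeff (Suc 0) k = 1 / real (Suc k)"
  by (simp add: beta_coeff_def)

lemma beta_coeff_Suc_fact:
  "beta_coeff (Suc N) k = fact N * fact k / fact (Suc N + k)"
proof -
  have "real ((Suc N + k) choose k) = fact (Suc N + k) / (fact k * fact (Suc N))"
    using binomial_fact[of k "Suc N + k", where ?'a = real]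
    by (simp del: fact_Suc binomial_Suc_Suc add_Suc)
  also have "fact (Suc N) = real (Suc N) * fact N"
    by simp
  finally show ?thesis
    unfolding beta_coeff_def by (simp del: fact_Suc binomial_Suc_Suc add_Suc of_nat_Suc)
qed

text \<open>Under the Beta integral this is \<open>x ^ k - x ^ (k + 1) = x ^ k * (1 - x)\<close>.\<close>

lemma beta_coeff_diff:
  assumes "n \<ge> 1"
  shows "beta_coeff (Suc n) k = beta_coeff n k - beta_coeff n (Suc k)"
proof -
  obtain N where n: "n = Suc N"
    using assms by (cases n) auto
  define F where "F = (fact (Suc N + k) :: real)"
  have F: "F \<noteq> 0"
    by (simp add: F_def)
  have 1: "fact (Suc (Suc N) + k) = (real N + real k + 2) * F"
          "fact (Suc N + Suc k) = (real N + real k + 2) * F"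
    by (simp_all add: F_def algebra_simps)
  have 2: "real N + real k + 2 \<noteq> 0"
    by linarith
  have "beta_coeff n k - beta_coeff n (Suc k)
      = fact N * fact k / F - fact N * ((real k + 1) * fact k) / ((real N + real k + 2) * F)"
    unfolding n beta_coeff_Suc_fact 1 by (simp add: F_def add.commute)
  also have "\<dots> = ((real N + 1) * fact N) * fact k / ((real N + real k + 2) * F)"
    using F 2 by (simp add: divide_simps) (simp add: algebra_simps)
  also have "\<dots> = beta_coeff (Suc n) k"
    unfolding n beta_coeff_Suc_fact 1 by (simp add: add.commute)
  finally show ?thesis by simp
qed

lemma beta_coeff_tendsto_0: "beta_coeff (Suc N) \<longlonglongrightarrow> 0"
proof (induction N)
  case 0
  show ?case
    unfolding beta_coeff_1[abs_def] by real_asymp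
next
  case (Suc N)
  have "(\<lambda>k. beta_coeff (Suc N) k - beta_coeff (Suc N) (Suc k)) \<longlonglongrightarrow> 0 - 0"
    by (intro tendsto_diff Suc.IH LIMSEQ_Suc)
  thus ?case
    using beta_coeff_diff[of "Suc N"] by simp
qed

text \<open>By \<open>beta_coeff_diff\<close> the series telescopes, and only \<open>beta_coeff N 0\<close> is left.\<close>

lemma beta_series_one:
  assumes "N \<ge> 1"
  shows "beta_coeff (Suc N) sums (1 / real N)"
proof -
  have "beta_coeff N \<longlonglongrightarrow> 0"
    using beta_coeff_tendsto_0[of "N - 1"] assms by simp
  from telescope_sums'[OF this]
  have "(\<lambda>k. beta_coeff N k - beta_coeff N (Suc k)) sums (1 / real N)"
    by simp
  thus ?thesis
    by (simp only: beta_coeff_diff[OF assms, symmetric])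
qed

text \<open>
  The power series of the logarithm converges at its boundary point \<open>t = -1\<close>, where it is the
  alternating harmonic series.
\<close>

lemma log_series:
  assumes "-1 \<le> t" "t < 1" "t \<noteq> 0"
  shows "(\<lambda>k. beta_coeff (Suc 0) k * t ^ k) sums (- ln (1 - t) / t)"
proof (cases "t = -1")
  case True
  thus ?thesis
    using alternating_harmonic_series_sums by (simp add: beta_coeff_1 field_simps)
next
  case False
  with assms have "\<bar>-t\<bar> < 1"
    by auto
  from ln_series'[OF this] have "(\<lambda>k. - (t ^ k) / real k) sums ln (1 - t)"
    by simp
  hence "(\<lambda>k. - (t ^ Suc k) / real (Suc k)) sums ln (1 - t)"
    using sums_Suc_iff[of "\<lambda>k. - (t ^ k) / real k"] by simp
  hence "(\<lambda>k. (- (t ^ Suc k) / real (Suc k)) * (- 1 / t)) sums (ln (1 - t) * (- 1 / t))"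
    by (rule sums_mult2)
  thus ?thesis
    using assms(3) by (simp add: beta_coeff_1 field_simps)
qed

lemma beta_series_step:
  assumes "n \<ge> 1" "t \<noteq> 0" "(\<lambda>k. beta_coeff n k * t ^ k) sums S"
  shows "(\<lambda>k. beta_coeff (Suc n) k * t ^ k) sums (1 / (real n * t) + (t - 1) / t * S)"
proof -
  have "(\<lambda>k. beta_coeff n (Suc k) * t ^ Suc k) sums (S - 1 / real n)"
    using assms(3) sums_Suc_iff[of "\<lambda>k. beta_coeff n k * t ^ k"] by simp
  hence "(\<lambda>k. beta_coeff n (Suc k) * t ^ Suc k * (1 / t)) sums ((S - 1 / real n) * (1 / t))"
    by (rule sums_mult2)
  from sums_diff[OF assms(3) this]
  have "(\<lambda>k. beta_coeff n k * t ^ k - beta_coeff n (Suc k) * t ^ k)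
          sums (S - (S - 1 / real n) * (1 / t))"
    using assms(2) by (simp add: field_simps)
  moreover have "S - (S - 1 / real n) * (1 / t) = 1 / (real n * t) + (t - 1) / t * S"
    using assms(1,2) by (simp add: field_simps)
  ultimately show ?thesis
    by (simp add: beta_coeff_diff[OF assms(1)] left_diff_distrib)
qed

text \<open>
  The solution of that recurrence: for \<open>t < 1\<close> and \<open>t \<noteq> 0\<close>, \<open>beta_value N t\<close> is the
  integral of \<open>(1 - x) ^ N / (1 - t * x)\<close> over \<open>[0, 1]\<close>.
\<close>

definition beta_value :: "nat \<Rightarrow> real \<Rightarrow> real" where
  "beta_value N t =
     ((t - 1) / t) ^ N * (- ln (1 - t) / t) + 1 / t * (\<Sum>i<N. ((t - 1) / t) ^ i / real (N - i))"

lemma beta_value_Suc: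
  "beta_value (Suc N) t = 1 / (real (Suc N) * t) + (t - 1) / t * beta_value N t"
proof -
  define w where "w = (t - 1) / t"
  have "(\<Sum>i<Suc N. w ^ i / real (Suc N - i)) = 1 / real (Suc N) + w * (\<Sum>i<N. w ^ i / real (N - i))"
    by (subst sum.lessThan_Suc_shift) (simp add: sum_distrib_left)
  thus ?thesis
    unfolding beta_value_def w_def[symmetric] by (simp add: algebra_simps)
qed

lemma beta_series:
  assumes "-1 \<le> t" "t < 1" "t \<noteq> 0"
  shows "(\<lambda>k. beta_coeff (Suc N) k * t ^ k) sums beta_value N t"
proof (induction N)
  case 0
  show ?case
    using log_series[OF assms] by (simp add: beta_value_def)
next
  case (Suc N)
  show ?case
    using beta_series_step[OF _ assms(3) Suc.IH] by (simp add: beta_value_Suc)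
qed

text \<open>
  The weights \<open>(1 - k * (1 - w)) * w ^ k = k * w ^ (k + 1) - (k - 1) * w ^ k\<close> are themselves
  differences, so this is Abel summation with the boundary term at the lower end equal to zero.
\<close>

lemma weighted_sum_by_parts:
  fixes c :: "nat \<Rightarrow> real"
  shows "(\<Sum>k=1..Suc N. (1 - real k * (1 - w)) * c k * w ^ k) =
           real (Suc N) * c (Suc N) * w ^ (N + 2)
           + (\<Sum>i<N. real (Suc i) * (c (Suc i) - c (i + 2)) * w ^ (i + 2))"
  by (induction N) (simp_all add: algebra_simps)

text \<open>
  Up to constant factors, summing against \<open>w ^ i\<close> turns the three parts into the second sum of
  \<open>closed_form\<close>, a geometric sum, and the sum in \<open>beta_value\<close>.
\<close>

lemma harm_weight_diff:
  assumes "i < N"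
  shows "real (Suc i) *
      ((harm (Suc i) + harm (Suc N - Suc i) - harm (Suc N)) -
       (harm (i + 2) + harm (Suc N - (i + 2)) - harm (Suc N)))
      = 1 / (real i + 2) - 2 + real (Suc N) / real (N - i)"
proof -
  obtain d where N: "N = Suc (i + d)"
    using assms less_iff_Suc_add by auto
  have "(harm (Suc i) + harm (Suc N - Suc i) - harm (Suc N)) -
        (harm (i + 2) + harm (Suc N - (i + 2)) - harm (Suc N))
        = 1 / (real d + 1) - 1 / (real i + 2)"
    by (simp add: N harm_Suc inverse_eq_divide add_ac)
  moreover have "real (Suc i) * (1 / (real d + 1) - 1 / (real i + 2))
      = 1 / (real i + 2) - 2 + real (Suc N) / real (N - i)"
  proof -
    have "real (Suc i) / (real i + 2) = 1 - 1 / (real i + 2)"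
      by (simp add: field_simps)
    moreover have "real (Suc N) / real (N - i) = 1 + real (Suc i) / (real d + 1)"
      by (simp add: N field_simps)
    ultimately show ?thesis
      by (simp add: right_diff_distrib)
  qed
  ultimately show ?thesis
    by presburger
qed

lemma closed_form_eq_beta_value:
  assumes "t \<noteq> 0" "t \<noteq> 1"
  shows "closed_form (Suc N) t = real (Suc N) * beta_value N t - 1"
proof -
  define w where "w = (t - 1) / t"
  define c where "c = (\<lambda>k. harm k + harm (Suc N - k) - harm (Suc N) :: real)"
  define P where "P = (\<Sum>i<N. 1 / (real i + 2) * w ^ i)"
  define Q where "Q = (\<Sum>i<N. w ^ i / real (N - i))"
  define G where "G = (\<Sum>i<N. w ^ i)"
  have w0: "w \<noteq> 0" and tw: "t * w = t - 1"
    using assms by (simp_all add: w_def)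
  have tk: "t - real k = t * (1 - real k * (1 - w))" for k
  proof -
    have "t * (1 - real k * (1 - w)) = t - real k * (t - t * w)"
      by (simp only: algebra_simps)
    thus ?thesis
      unfolding tw by simp
  qed
  have "(\<Sum>k=1..Suc N. (t - real k) * c k * w ^ k)
      = t * (\<Sum>k=1..Suc N. (1 - real k * (1 - w)) * c k * w ^ k)"
    unfolding tk sum_distrib_left by (simp only: mult.assoc)
  (* The boundary term of the summation by parts vanishes because c (Suc N) = 0. *)
  also have "(\<Sum>k=1..Suc N. (1 - real k * (1 - w)) * c k * w ^ k)
      = (\<Sum>i<N. real (Suc i) * (c (Suc i) - c (i + 2)) * w ^ (i + 2))"
    unfolding weighted_sum_by_parts by (simp add: c_def harm_def)
  also have "\<dots> = (\<Sum>i<N. (1 / (real i + 2) - 2 + real (Suc N) / real (N - i)) * w ^ (i + 2))"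
    by (intro sum.cong refl) (simp only: c_def harm_weight_diff lessThan_iff)
  also have "\<dots> = w\<^sup>2 * (P - 2 * G + real (Suc N) * Q)"
    unfolding P_def Q_def G_def sum_distrib_left sum_subtractf[symmetric] sum.distrib[symmetric]
    by (intro sum.cong refl) (simp add: power2_eq_square algebra_simps)
  finally have main: "(\<Sum>k=1..Suc N. (t - real k) * c k * w ^ k)
      = t * w\<^sup>2 * (P - 2 * G + real (Suc N) * Q)"
    by simp
  have "(1 - t)\<^sup>2 = (t * w)\<^sup>2"
    unfolding tw by (simp add: power2_commute)
  hence first: "1 / (1 - t)\<^sup>2 * (\<Sum>k=1..Suc N. (t - real k) * c k * w ^ k)
      = 1 / t * (P - 2 * G + real (Suc N) * Q)"
    unfolding main using assms w0 by (simp add: field_simps power2_eq_square)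
  have geo: "1 / t * G = 1 - w ^ N"
  proof -
    have "1 - w = 1 / t"
      using assms by (simp add: w_def field_simps)
    thus ?thesis
      using one_diff_power_eq[of w N] by (simp add: G_def)
  qed
  have denom: "1 - t = - (t * w)"
    using tw by simp
  have "(2 * t + a) / - (t * w) * w ^ Suc N = - 2 * w ^ N + w ^ N * (- a / t)" for a
    using assms(1) w0 by (simp add: divide_simps) (simp add: algebra_simps)
  from this[of "real (Suc N) * ln (1 - t)"]
  have last: "(2 * t + real (Suc N) * ln (1 - t)) / (1 - t) * w ^ Suc N
      = - 2 * w ^ N + real (Suc N) * (w ^ N * (- ln (1 - t) / t))"
    unfolding denom[symmetric] by (simp only: mult_ac times_divide_eq_right mult_minus_right)
  have "closed_form (Suc N) t
      = 1 / t * (P - 2 * G + real (Suc N) * Q) - 1 / t * P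
        + (- 2 * w ^ N + real (Suc N) * (w ^ N * (- ln (1 - t) / t))) + 1"
    unfolding closed_form_def w_def[symmetric] first[symmetric] last[symmetric]
    by (simp add: c_def P_def)
  also have "\<dots> = real (Suc N) * (w ^ N * (- ln (1 - t) / t) + 1 / t * Q)
        - 2 * (1 / t * G) - 2 * w ^ N + 1"
    by (simp add: algebra_simps)
  also have "\<dots> = real (Suc N) * beta_value N t - 1"
    unfolding geo by (simp add: beta_value_def w_def Q_def)
  finally show ?thesis .
qed

text \<open>
  One factor \<open>(t - 1) / t\<close> suffices to make the logarithmic term vanish in the limit; for
  \<open>N = 0\<close> there is none, and \<open>beta_value\<close> is unbounded near \<open>1\<close>.
\<close>

lemma beta_value_tendsto:
  assumes "N \<ge> 1"
  shows "(beta_value N \<longlongrightarrow> 1 / real N) (at_left 1)"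
proof -
  obtain M where N: "N = Suc M"
    using assms by (cases N) auto
  have w: "((\<lambda>t::real. (t - 1) / t) \<longlongrightarrow> 0) (at_left 1)"
    by real_asymp
  have log: "((\<lambda>t::real. (t - 1) / t * (- ln (1 - t) / t)) \<longlongrightarrow> 0) (at_left 1)"
    by real_asymp
  have inv: "((\<lambda>t::real. 1 / t) \<longlongrightarrow> 1) (at_left 1)"
    by real_asymp
  have "((\<lambda>t::real. ((t - 1) / t) ^ M * ((t - 1) / t * (- ln (1 - t) / t))
            + 1 / t * (\<Sum>i<N. ((t - 1) / t) ^ i / real (N - i)))
        \<longlongrightarrow> 0 ^ M * 0 + 1 * (\<Sum>i<N. 0 ^ i / real (N - i))) (at_left 1)"
    by (intro tendsto_intros w log inv) auto
  moreover have "(\<Sum>i<N. 0 ^ i / real (N - i)) = 1 / real N"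
    unfolding N by (subst sum.lessThan_Suc_shift) simp
  ultimately show ?thesis
    by (simp add: beta_value_def[abs_def] N mult_ac)
qed

text \<open>The \<open>-1\<close> removes the term \<open>k = 0\<close>.\<close>

lemma binomial_series_from_beta_series:
  assumes "(\<lambda>k. beta_coeff (Suc N) k * t ^ k) sums S"
  shows "(\<lambda>k. t ^ Suc k / real ((Suc N + Suc k) choose Suc k)) sums (real (Suc N) * S - 1)"
proof -
  have "(\<lambda>k. real (Suc N) * (beta_coeff (Suc N) k * t ^ k)) sums (real (Suc N) * S)"
    using assms by (rule sums_mult)
  moreover have "real (Suc N) * (beta_coeff (Suc N) k * t ^ k)
      = t ^ k / real ((Suc N + k) choose k)" for k
    by (simp add: beta_coeff_def del: of_nat_Suc binomial_Suc_Suc)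
  ultimately have "(\<lambda>k. t ^ k / real ((Suc N + k) choose k)) sums (real (Suc N) * S)"
    by simp
  thus ?thesis
    using sums_Suc_iff[of "\<lambda>k. t ^ k / real ((Suc N + k) choose k)"] by simp
qed

theorem theorem2p19:
  fixes n :: nat and t :: real
  assumes "n \<ge> 1" and "t \<noteq> 0"
    and "n = 1 \<Longrightarrow> -1 \<le> t \<and> t < 1"
    and "n \<ge> 2 \<Longrightarrow> \<bar>t\<bar> \<le> 1"
  shows "(t \<noteq> 1 \<longrightarrow>
            (\<lambda>k. t ^ Suc k / real ((n + Suc k) choose Suc k)) sums closed_form n t) \<and>
         (t = 1 \<longrightarrow>
            (\<exists>L. (closed_form n \<longlongrightarrow> L) (at_left 1) \<and>
                 (\<lambda>k. t ^ Suc k / real ((n + Suc k) choose Suc k)) sums L))"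
proof -
  obtain N where n: "n = Suc N"
    using assms(1) by (cases n) auto
  have range: "-1 \<le> t" "t \<le> 1"
    using assms(1,3,4) by (cases "n = 1"; force)+
  show ?thesis
  proof (intro conjI impI)
    assume "t \<noteq> 1"
    with range assms(2)
    have "(\<lambda>k. beta_coeff (Suc N) k * t ^ k) sums beta_value N t"
      by (intro beta_series) auto
    from binomial_series_from_beta_series[OF this]
    show "(\<lambda>k. t ^ Suc k / real ((n + Suc k) choose Suc k)) sums closed_form n t"
      unfolding n closed_form_eq_beta_value[OF assms(2) \<open>t \<noteq> 1\<close>] .
  next
    assume t: "t = 1"
    hence N: "N \<ge> 1"
      using assms(3) by (cases N) (auto simp: n)
    have "((\<lambda>s. real (Suc N) * beta_value N s - 1) \<longlongrightarrow> real (Suc N) * (1 / real N) - 1) (at_left 1)"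
      by (intro tendsto_intros beta_value_tendsto N)
    moreover have "\<forall>\<^sub>F s in at_left 1. real (Suc N) * beta_value N s - 1 = closed_form n s"
      using eventually_at_left_real[of 0 "1 :: real"]
      by (auto simp: n closed_form_eq_beta_value elim: eventually_mono)
    ultimately have "(closed_form n \<longlongrightarrow> real (Suc N) * (1 / real N) - 1) (at_left 1)"
      by (rule Lim_transform_eventually)
    moreover have "(\<lambda>k. t ^ Suc k / real ((n + Suc k) choose Suc k))
        sums (real (Suc N) * (1 / real N) - 1)"
      unfolding n using beta_series_one[OF N]
      by (intro binomial_series_from_beta_series) (simp add: t)
    ultimately show "\<exists>L. (closed_form n \<longlongrightarrow> L) (at_left 1) \<and>
        (\<lambda>k. t ^ Suc k / real ((n + Suc k) choose Suc k)) sums L"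
      by blast
  qed
qed

end
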